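(* Let $f\colon\mathbb{R}^n\to\mathbb{R}^n$ be a tropical algebraic rational map with linear pieces $(f_i,C_i)$, $i=1,\dots,N$. For $x\in\mathbb{R}^n$ let $I(x)=\{i : x\in C_i\}$ and let $\partial_f(x)\subset \mathrm{Mat}_{n\times n}(\mathbb{R})$ be the convex hull of the set of Jacobian matrices of the maps $f_i$, $i\in I(x)$. If for every $x\in\mathbb{R}^n$ the set $\partial_f(x)$ contains no singular matrix, then $f$ is an isomorphism.
   Context: Here "linear" means polynomial of degree at most one (constant terms are allowed). A tropical algebraic rational function on $\mathbb{R}^n$ is a function $\mathbb{R}^n\to\mathbb{R}$ of the form $\min\{A_1,\dots,A_k\}-\min\{B_1,\dots,B_l\}$, where $A_1,\dots,A_k,B_1,\dots,B_l$ are linear functions with rational coefficients. A tropical algebraic rational map $\mathbb{R}^n\to\mathbb{R}^m$ is a map each of whose coordinates is a tropical algebraic rational function. For such a map $f$ there is a finite decomposition $\mathbb{R}^n=\bigcup_{i=1}^N C_i$ into closed $n$-dimensional (convex) polyhedra with pairwise disjoint interiors, together with linear maps $f_i$ such that $f=f_i$ on $C_i$; the pairs $(f_i,C_i)$ (or just the $f_i$) are called the linear pieces of $f$. A tropical algebraic rational map $\mathbb{R}^n\to\mathbb{R}^n$ is called an isomorphism if it is a bijection (its inverse is then also a tropical algebraic rational map). *)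

theory Defs
  imports "HOL-Analysis.Analysis"
begin

text \<open>Throughout, ``linear'' means polynomial of degree at most one.  The constant term
  counts as a coefficient, so it is rational as well in the following definition.\<close>

definition rational_linear_function :: "(real ^ 'n \<Rightarrow> real) \<Rightarrow> bool" where
  "rational_linear_function h \<longleftrightarrow>
     (\<exists>a c. (\<forall>j. a $ j \<in> \<rat>) \<and> c \<in> \<rat> \<and> (\<forall>x. h x = (\<Sum>j\<in>UNIV. a $ j * x $ j) + c))"

definition tropical_rational_function :: "(real ^ 'n \<Rightarrow> real) \<Rightarrow> bool" where
  "tropical_rational_function h \<longleftrightarrow>
     (\<exists>(k::nat) (l::nat) A B. k \<ge> 1 \<and> l \<ge> 1 \<and>
        (\<forall>i\<in>{1..k}. rational_linear_function (A i)) \<and>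
        (\<forall>j\<in>{1..l}. rational_linear_function (B j)) \<and>
        (\<forall>x. h x = (MIN i\<in>{1..k}. A i x) - (MIN j\<in>{1..l}. B j x)))"

definition tropical_rational_map :: "(real ^ 'n \<Rightarrow> real ^ 'm) \<Rightarrow> bool" where
  "tropical_rational_map f \<longleftrightarrow> (\<forall>i. tropical_rational_function (\<lambda>x. f x $ i))"

definition tropical_isomorphism :: "(real ^ 'n \<Rightarrow> real ^ 'n) \<Rightarrow> bool" where
  "tropical_isomorphism f \<longleftrightarrow> tropical_rational_map f \<and> bij f"

definition linear_polynomial_map :: "(real ^ 'n \<Rightarrow> real ^ 'm) \<Rightarrow> bool" where
  "linear_polynomial_map g \<longleftrightarrow> (\<exists>M c. \<forall>x. g x = M *v x + c)"

definition linear_pieces ::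
  "(real ^ 'n \<Rightarrow> real ^ 'm) \<Rightarrow> nat \<Rightarrow> (nat \<Rightarrow> real ^ 'n \<Rightarrow> real ^ 'm) \<Rightarrow> (nat \<Rightarrow> (real ^ 'n) set) \<Rightarrow> bool"
where
  "linear_pieces f N g C \<longleftrightarrow>
     (\<Union>i\<in>{1..N}. C i) = UNIV \<and>
     (\<forall>i\<in>{1..N}. polyhedron (C i) \<and> aff_dim (C i) = int CARD('n)) \<and>
     (\<forall>i\<in>{1..N}. \<forall>j\<in>{1..N}. i \<noteq> j \<longrightarrow> interior (C i) \<inter> interior (C j) = {}) \<and>
     (\<forall>i\<in>{1..N}. linear_polynomial_map (g i) \<and> (\<forall>x\<in>C i. f x = g i x))"

definition active_pieces :: "nat \<Rightarrow> (nat \<Rightarrow> (real ^ 'n) set) \<Rightarrow> real ^ 'n \<Rightarrow> nat set" where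
  "active_pieces N C x = {i\<in>{1..N}. x \<in> C i}"

text \<open>The Jacobian matrix of a linear piece is constant; it is evaluated at \<open>x\<close> only because
  \<^const>\<open>jacobian\<close> requires a point.\<close>

definition jacobian_hull ::
  "nat \<Rightarrow> (nat \<Rightarrow> real ^ 'n \<Rightarrow> real ^ 'm) \<Rightarrow> (nat \<Rightarrow> (real ^ 'n) set) \<Rightarrow> real ^ 'n \<Rightarrow> (real ^ 'n ^ 'm) set"
where
  "jacobian_hull N g C x = convex hull ((\<lambda>i. jacobian (g i) (at x)) ` active_pieces N C x)"

end

(* Along a segment that only meets pieces active at x, f y' - f y = M (y' - y) for some M in
   the hull at x (Clarke's mean value argument); so f is locally injective, hence open by
   invariance of domain. Every piece is invertible, so f is proper. A proper local homeomorphism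
   of R^n is a covering map, and as R^n is simply connected it is a bijection. *)
theory Submission
  imports Defs
begin

section \<open>Proper locally injective maps\<close>

lemma proper_imp_closed_image:
  fixes f :: "'a::euclidean_space \<Rightarrow> 'b::euclidean_space"
  assumes "\<And>K. compact K \<Longrightarrow> compact (f -` K)" and "closed S"
  shows "closed (f ` S)"
  using proper_map[of UNIV S UNIV f] assms by auto

text \<open>Openness is local: around each point of \<open>S\<close>, invariance of domain applies
  on a ball where \<open>f\<close> is injective.\<close>

lemma locally_injective_imp_open_image:
  fixes f :: "'a::euclidean_space \<Rightarrow> 'a"
  assumes cont: "continuous_on UNIV f"
    and inj: "\<And>x. \<exists>r>0. inj_on f (ball x r)"
    and S: "open S"
  shows "open (f ` S)"
proof (subst open_subopen, clarify)
  fix x assume "x \<in> S"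
  obtain r where r: "r > 0" "inj_on f (ball x r)" using inj by blast
  have "open (f ` (ball x r \<inter> S))"
    by (rule invariance_of_domain)
       (use r S cont in \<open>auto intro: continuous_on_subset inj_on_subset\<close>)
  then show "\<exists>T. open T \<and> f x \<in> T \<and> T \<subseteq> f ` S"
    using \<open>x \<in> S\<close> r(1) by (intro exI[of _ "f ` (ball x r \<inter> S)"]) auto
qed

text \<open>The range is open by local injectivity and closed by properness; being nonempty, it is
  the whole connected space.\<close>

lemma proper_locally_injective_imp_surj:
  fixes f :: "'a::euclidean_space \<Rightarrow> 'a"
  assumes "continuous_on UNIV f"
    and "\<And>x. \<exists>r>0. inj_on f (ball x r)"
    and "\<And>K. compact K \<Longrightarrow> compact (f -` K)"
  shows "range f = UNIV"
proof -
  have "open (range f)" "closed (range f)"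
    using locally_injective_imp_open_image[OF assms(1,2)] proper_imp_closed_image[OF assms(3)]
    by auto
  then show ?thesis
    using clopen[of "range f"] by auto
qed

text \<open>A limit point of a fibre would have infinitely many fibre points in a ball where
  \<open>f\<close> is injective. So the fibre is compact without limit points.\<close>

lemma proper_locally_injective_imp_finite_fibre:
  fixes f :: "'a::euclidean_space \<Rightarrow> 'a"
  assumes inj: "\<And>x. \<exists>r>0. inj_on f (ball x r)"
    and proper: "\<And>K. compact K \<Longrightarrow> compact (f -` K)"
  shows "finite (f -` {y})"
proof -
  have "\<not> x islimpt (f -` {y})" for x
  proof
    assume lim: "x islimpt (f -` {y})"
    obtain r where r: "r > 0" "inj_on f (ball x r)" using inj by blast
    have "infinite (f -` {y} \<inter> ball x r)"
      using lim r(1) islimpt_eq_infinite_ball by blast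
    moreover have "finite (f -` {y} \<inter> ball x r)"
      by (rule finite_vimage_IntI[OF _ r(2)]) simp
    ultimately show False by blast
  qed
  then show ?thesis
    using finite_not_islimpt_in_compact[of "f -` {y}" "f -` {y}"] proper[of "{y}"] by simp
qed

lemma finite_separated:
  fixes F :: "'a::metric_space set"
  assumes "finite F"
  obtains d where "d > 0" "\<And>x y. x \<in> F \<Longrightarrow> y \<in> F \<Longrightarrow> x \<noteq> y \<Longrightarrow> d \<le> dist x y"
proof -
  \<comment> \<open>The extra element 1 keeps \<open>D\<close> nonempty when \<open>F\<close> has at
    most one point.\<close>
  define D where "D = insert 1 ((\<lambda>(x, y). dist x y) ` (F \<times> F - Id))"
  have "finite D" "D \<noteq> {}" using assms by (auto simp: D_def)
  moreover have "\<forall>d\<in>D. d > 0" by (auto simp: D_def)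
  ultimately have "Min D > 0" by simp
  moreover have "Min D \<le> dist x y" if "x \<in> F" "y \<in> F" "x \<noteq> y" for x y
    using \<open>finite D\<close> that by (intro Min_le) (force simp: D_def)+
  ultimately show ?thesis using that by blast
qed

text \<open>Each point of the finite fibre over \<open>y\<close> gets its own small ball. Properness
  then yields a neighbourhood of \<open>y\<close> whose preimage lies entirely in these balls, so
  they provide the sheets.\<close>

lemma proper_locally_injective_imp_covering_space:
  fixes f :: "'a::euclidean_space \<Rightarrow> 'a"
  assumes cont: "continuous_on UNIV f"
    and inj: "\<And>x. \<exists>r>0. inj_on f (ball x r)"
    and proper: "\<And>K. compact K \<Longrightarrow> compact (f -` K)"
  shows "covering_space UNIV f UNIV"
proof
  show "continuous_on UNIV f" by fact
  show surj: "range f = UNIV"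
    by (rule proper_locally_injective_imp_surj[OF assms])
  fix y :: 'a
  define F where "F = f -` {y}"
  have fin: "finite F"
    unfolding F_def by (rule proper_locally_injective_imp_finite_fibre[OF inj proper])
  have ne: "F \<noteq> {}" using surjD[OF surj, of y] by (auto simp: F_def)
  obtain d where d: "d > 0" "\<And>x x'. x \<in> F \<Longrightarrow> x' \<in> F \<Longrightarrow> x \<noteq> x' \<Longrightarrow> d \<le> dist x x'"
    using finite_separated[OF fin] by blast
  obtain r where r: "\<And>x. r x > 0" "\<And>x. inj_on f (ball x (r x))"
    using inj by metis
  \<comment> \<open>The bound \<open>r x\<close> gives injectivity on the ball, and half the
    separation \<open>d\<close> makes balls around distinct fibre points disjoint.\<close>
  define U where "U x = ball x (min (r x) (d / 2))" for x
  have opU: "open (U x)" and inU: "x \<in> U x" and injU: "inj_on f (U x)" for x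
    using r d(1) by (auto simp: U_def intro: inj_on_subset[OF r(2)])
  have disjU: "U x \<inter> U x' = {}" if "x \<in> F" "x' \<in> F" "x \<noteq> x'" for x x'
  proof (rule ccontr)
    assume "U x \<inter> U x' \<noteq> {}"
    then obtain z where "dist x z < d / 2" "dist x' z < d / 2" by (auto simp: U_def)
    then have "dist x x' < d" by (metis dist_triangle_half_l dist_commute)
    with d(2)[OF that] show False by simp
  qed
  \<comment> \<open>The intersection makes \<open>T\<close> reachable from every ball. The
    subtracted set removes values also attained outside the balls; it is closed because
    \<open>f\<close> is proper, and it misses \<open>y\<close> because the whole fibre lies inside
    the balls.\<close>
  define T where "T = (\<Inter>x\<in>F. f ` U x) - f ` (- (\<Union>x\<in>F. U x))"
  have "open (f ` U x)" for x
    by (rule locally_injective_imp_open_image[OF cont inj opU])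
  moreover have "closed (f ` (- (\<Union>x\<in>F. U x)))"
    using opU by (intro proper_imp_closed_image[OF proper] closed_Compl open_UN) auto
  ultimately have opT: "open T"
    unfolding T_def using fin by (intro open_Diff open_INT) auto
  have yT: "y \<in> T"
    using inU by (force simp: T_def F_def)
  define V where "V x = U x \<inter> f -` T" for x
  have opV: "open (V x)" for x
    unfolding V_def using opU opT cont by (intro open_Int) (auto simp: open_vimage)
  \<comment> \<open>By the subtraction in \<open>T\<close>, a point mapped into \<open>T\<close>
    cannot lie outside all the balls \<open>U x\<close>.\<close>
  have "\<Union>(V ` F) = f -` T"
    by (auto simp: V_def T_def)
  moreover have "pairwise disjnt (V ` F)"
    using disjU by (auto simp: pairwise_def disjnt_def V_def)
  moreover have "\<exists>q. homeomorphism (V x) T f q" if "x \<in> F" for x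
  proof -
    have "T \<subseteq> f ` U x" using that by (auto simp: T_def)
    then have "f ` V x = T" unfolding V_def by blast
    moreover obtain q where "homeomorphism (V x) (f ` V x) f q"
      by (rule invariance_of_domain_homeomorphism[of "V x" f])
         (use opV cont injU in \<open>auto intro: continuous_on_subset inj_on_subset simp: V_def\<close>)
    ultimately show ?thesis by auto
  qed
  ultimately show "\<exists>T. y \<in> T \<and> openin (top_of_set UNIV) T \<and>
      (\<exists>v. \<Union>v = UNIV \<inter> f -` T \<and> (\<forall>u\<in>v. openin (top_of_set UNIV) u) \<and>
           pairwise disjnt v \<and> (\<forall>u\<in>v. \<exists>q. homeomorphism u T f q))"
    using opT yT opV by (intro exI[of _ T] conjI exI[of _ "V ` F"]) auto
qed

text \<open>A path joining two points of one fibre projects to a loop, which is null-homotopic in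
  \<open>S\<close>. By monodromy its lift ends where the constant lift ends, so the two points
  coincide.\<close>

lemma covering_space_simply_connected_imp_inj_on:
  fixes p :: "'a::real_normed_vector \<Rightarrow> 'b::real_normed_vector"
  assumes cov: "covering_space C p S" and C: "path_connected C" and S: "simply_connected S"
  shows "inj_on p C"
proof
  fix a b assume ab: "a \<in> C" "b \<in> C" "p a = p b"
  obtain h where h: "path h" "path_image h \<subseteq> C" "pathstart h = a" "pathfinish h = b"
    using C ab unfolding path_connected_def by blast
  have pC: "p ` C = S" and cont: "continuous_on C p"
    using cov by (auto simp: covering_space_def)
  have "path (p \<circ> h)"
    using h(1,2) cont by (intro path_continuous_image) (auto intro: continuous_on_subset)
  moreover have "path_image (p \<circ> h) \<subseteq> S"
    using h(2) pC by (auto simp: path_image_compose)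
  moreover have "pathstart (p \<circ> h) = p a" "pathfinish (p \<circ> h) = p a"
    using h ab by (auto simp: pathstart_compose pathfinish_compose)
  ultimately have hom: "homotopic_paths S (p \<circ> h) (linepath (p a) (p a))"
    using S unfolding simply_connected_eq_contractible_path by metis
  have "pathfinish h = pathfinish (linepath a a)"
    by (rule covering_space_monodromy[OF cov _ _ _ _ hom])
       (use h ab pC \<open>path (p \<circ> h)\<close> \<open>path_image (p \<circ> h) \<subseteq> S\<close> in auto)
  then show "a = b" using h by simp
qed

lemma proper_locally_injective_imp_bij:
  fixes f :: "'a::euclidean_space \<Rightarrow> 'a"
  assumes "continuous_on UNIV f"
    and "\<And>x. \<exists>r>0. inj_on f (ball x r)"
    and "\<And>K. compact K \<Longrightarrow> compact (f -` K)"
  shows "bij f"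
proof -
  have "covering_space UNIV f UNIV"
    by (rule proper_locally_injective_imp_covering_space[OF assms])
  then have "inj f"
    by (rule covering_space_simply_connected_imp_inj_on)
       (auto intro: convex_imp_simply_connected convex_imp_path_connected)
  moreover have "surj f" by (rule proper_locally_injective_imp_surj[OF assms])
  ultimately show ?thesis by (simp add: bij_def)
qed

section \<open>Piecewise linear maps\<close>

text \<open>Induction on the number of pieces: the piece containing \<open>a\<close> is used up to its last
  point \<open>c\<close>, and beyond \<open>c\<close> the other pieces suffice.\<close>

lemma piecewise_linear_increment_in_convex:
  fixes h :: "real \<Rightarrow> 'a::real_vector" and T :: "'i \<Rightarrow> real set"
  assumes "finite I" and "convex K"
    and "\<And>i. i \<in> I \<Longrightarrow> closed (T i)"
    and "\<And>i. i \<in> I \<Longrightarrow> v i \<in> K"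
    and "\<And>i s t. i \<in> I \<Longrightarrow> s \<in> T i \<Longrightarrow> t \<in> T i \<Longrightarrow> h t - h s = (t - s) *\<^sub>R v i"
    and "a \<le> b" and "{a..b} \<subseteq> (\<Union>i\<in>I. T i)"
  shows "\<exists>k\<in>K. h b - h a = (b - a) *\<^sub>R k"
  using assms(1,3-7)
proof (induction I arbitrary: a rule: finite_psubset_induct)
  case (psubset I)
  have "a \<in> (\<Union>i\<in>I. T i)" using psubset.prems(4,5) by auto
  then obtain i where i: "i \<in> I" "a \<in> T i" by blast
  have comp: "compact (T i \<inter> {a..b})"
    using psubset.prems(1)[OF i(1)] by (intro closed_Int_compact) auto
  have "T i \<inter> {a..b} \<noteq> {}" using i psubset.prems(4) by auto
  from compact_attains_sup[OF comp this] obtain c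
    where c: "c \<in> T i" "a \<le> c" "c \<le> b" and cmax: "\<And>t. t \<in> T i \<inter> {a..b} \<Longrightarrow> t \<le> c"
    by auto
  have hc: "h c - h a = (c - a) *\<^sub>R v i"
    using psubset.prems(3)[OF i(1) i(2) c(1)] .
  show ?case
  proof (cases "c = b")
    case True
    then show ?thesis using hc psubset.prems(2)[OF i(1)] by blast
  next
    case False
    then have cb: "c < b" using c(3) by simp
    have cl: "closed (\<Union>j\<in>I - {i}. T j)"
      using psubset.prems(1) psubset.hyps by (intro closed_UN) auto
    have sub: "{c<..b} \<subseteq> (\<Union>j\<in>I - {i}. T j)"
    proof
      fix t assume t: "t \<in> {c<..b}"
      then have "t \<in> {a..b}" using c(2) by simp
      moreover from this have "t \<notin> T i" using cmax[of t] t by auto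
      ultimately show "t \<in> (\<Union>j\<in>I - {i}. T j)" using psubset.prems(5) by blast
    qed
    \<comment> \<open>The induction hypothesis needs a closed interval. The remaining pieces have a
      closed union, so covering everything beyond \<open>c\<close> forces them to cover
      \<open>c\<close> as well.\<close>
    have "closure {c<..b} = {c..b}" using cb by (rule closure_greaterThanAtMost)
    then have "{c..b} \<subseteq> (\<Union>j\<in>I - {i}. T j)"
      using closure_minimal[OF sub cl] by simp
    moreover have "I - {i} \<subset> I" using i(1) by blast
    ultimately obtain k where k: "k \<in> K" "h b - h c = (b - c) *\<^sub>R k"
      using psubset.IH[of "I - {i}" c] psubset.prems(1,2,3) c(3) by (metis Diff_iff)
    have ab: "a < b" using c(2) cb by simp
    \<comment> \<open>The average slope over \<open>{a..b}\<close> is the mean of the slopes on the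
      two subintervals, weighted by their relative lengths; convexity keeps it in
      \<open>K\<close>.\<close>
    define m where "m = ((c - a) / (b - a)) *\<^sub>R v i + ((b - c) / (b - a)) *\<^sub>R k"
    have "m \<in> K" unfolding m_def
      using ab c(2,3) k(1) psubset.prems(2)[OF i(1)]
      by (intro convexD[OF assms(2)]) (auto simp: add_divide_distrib[symmetric])
    moreover have "h b - h a = (b - a) *\<^sub>R m"
    proof -
      have "h b - h a = (h c - h a) + (h b - h c)" by simp
      also have "\<dots> = (b - a) *\<^sub>R m"
        using ab by (simp add: m_def hc k(2) scaleR_add_right)
      finally show ?thesis .
    qed
    ultimately show ?thesis by blast
  qed
qed

text \<open>Restricting \<open>f\<close> to the segment reduces this to one real variable: the
  pieces become closed sets of parameters, with slopes \<open>A i *v (y - x)\<close>.\<close>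

lemma piecewise_affine_mean_value:
  fixes f :: "real ^ 'n \<Rightarrow> real ^ 'm" and A :: "'i \<Rightarrow> real ^ 'n ^ 'm"
  assumes "finite I"
    and closed: "\<And>i. i \<in> I \<Longrightarrow> closed (C i)"
    and affine: "\<And>i x. i \<in> I \<Longrightarrow> x \<in> C i \<Longrightarrow> f x = A i *v x + b i"
    and seg: "closed_segment x y \<subseteq> (\<Union>i\<in>I. C i)"
  shows "\<exists>M\<in>convex hull (A ` I). f y - f x = M *v (y - x)"
proof -
  define \<gamma> where "\<gamma> t = x + t *\<^sub>R (y - x)" for t :: real
  \<comment> \<open>Evaluation at \<open>y - x\<close> is linear in the matrix, so \<open>K\<close>
    is convex. A slope found in \<open>K\<close> is by construction the value of a single matrix of
    the hull.\<close>
  define K where "K = (\<lambda>M. M *v (y - x)) ` (convex hull (A ` I))"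
  have "linear (\<lambda>M. M *v (y - x))"
    by (rule linearI)
       (auto simp: matrix_vector_mult_add_rdistrib scaleR_matrix_vector_assoc)
  then have "convex K"
    unfolding K_def by (intro convex_linear_image) auto
  have cont: "continuous_on UNIV \<gamma>"
    unfolding \<gamma>_def by (intro continuous_intros)
  have "\<exists>k\<in>K. f (\<gamma> 1) - f (\<gamma> 0) = (1 - 0) *\<^sub>R k"
  proof (rule piecewise_linear_increment_in_convex[where h = "f \<circ> \<gamma>" and I = I
        and T = "\<lambda>i. \<gamma> -` C i" and v = "\<lambda>i. A i *v (y - x)", unfolded o_def])
    show "closed (\<gamma> -` C i)" if "i \<in> I" for i
      using closed[OF that] cont by (simp add: closed_vimage)
    show "A i *v (y - x) \<in> K" if "i \<in> I" for i
      unfolding K_def using that by (intro imageI hull_inc)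
    show "f (\<gamma> t) - f (\<gamma> s) = (t - s) *\<^sub>R (A i *v (y - x))"
      if "i \<in> I" "s \<in> \<gamma> -` C i" "t \<in> \<gamma> -` C i" for i s t
    proof -
      have "f (\<gamma> t) - f (\<gamma> s) = A i *v (\<gamma> t - \<gamma> s)"
        using that affine by (simp add: matrix_vector_mult_diff_distrib)
      also have "\<gamma> t - \<gamma> s = (t - s) *\<^sub>R (y - x)"
        by (simp add: \<gamma>_def scaleR_left_diff_distrib)
      finally show ?thesis by (simp add: matrix_vector_mult_scaleR)
    qed
    show "{0..1} \<subseteq> (\<Union>i\<in>I. \<gamma> -` C i)"
    proof
      fix t :: real assume "t \<in> {0..1}"
      then have "\<gamma> t \<in> closed_segment x y"
        by (auto simp: \<gamma>_def in_segment algebra_simps intro!: exI[of _ t])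
      then show "t \<in> (\<Union>i\<in>I. \<gamma> -` C i)" using seg by auto
    qed
  qed (use \<open>finite I\<close> \<open>convex K\<close> in auto)
  then show ?thesis by (auto simp: K_def \<gamma>_def)
qed

text \<open>The finitely many closed sets missing \<open>x\<close> have a closed union. For the
  pieces of \<open>f\<close> this means that only those active at \<open>x\<close> matter near
  \<open>x\<close>.\<close>

lemma ball_avoiding_finite_closed:
  fixes x :: "'a::metric_space"
  assumes "finite I" and "\<And>i. i \<in> I \<Longrightarrow> closed (C i)"
  obtains r where "r > 0" "\<And>i. i \<in> I \<Longrightarrow> x \<notin> C i \<Longrightarrow> ball x r \<inter> C i = {}"
proof -
  have "open (- (\<Union>i\<in>{i\<in>I. x \<notin> C i}. C i))"
    using assms by (intro open_Compl closed_UN) auto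
  then obtain r where "r > 0" "ball x r \<subseteq> - (\<Union>i\<in>{i\<in>I. x \<notin> C i}. C i)"
    using open_contains_ball by (metis (mono_tags, lifting) ComplI UN_E mem_Collect_eq)
  then show ?thesis by (intro that) auto
qed

text \<open>A left inverse of \<open>A\<close> recovers \<open>x\<close> from its value, so the
  preimage lies in a linear image of a translate of \<open>S\<close>.\<close>

lemma bounded_vimage_invertible_affine:
  fixes A :: "real ^ 'n ^ 'n"
  assumes "invertible A" and "bounded S"
  shows "bounded {x. A *v x + b \<in> S}"
proof -
  obtain B where B: "B ** A = mat 1"
    using assms(1) by (auto simp: invertible_def)
  have "bounded ((*v) B ` ((\<lambda>y. - b + y) ` S))"
    using assms(2) by (intro bounded_linear_image bounded_translation) auto
  moreover have "{x. A *v x + b \<in> S} \<subseteq> (*v) B ` ((\<lambda>y. - b + y) ` S)"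
  proof
    fix x assume "x \<in> {x. A *v x + b \<in> S}"
    moreover have "x = B *v (- b + (A *v x + b))"
      using B by (simp add: matrix_vector_mul_assoc)
    ultimately show "x \<in> (*v) B ` ((\<lambda>y. - b + y) ` S)" by blast
  qed
  ultimately show ?thesis by (rule bounded_subset)
qed

lemma jacobian_affine:
  fixes A :: "real ^ 'n ^ 'm"
  shows "jacobian (\<lambda>x. A *v x + b) (at x) = A"
proof -
  have "((\<lambda>x. A *v x + b) has_derivative (*v) A) (at x)"
    by (auto intro!: derivative_eq_intros bounded_linear_imp_has_derivative)
  then show ?thesis
    by (simp add: jacobian_def frechet_derivative_at[symmetric])
qed

theorem mainTheorem1:
  fixes f :: "real ^ 'n \<Rightarrow> real ^ 'n"
    and N :: nat
    and g :: "nat \<Rightarrow> real ^ 'n \<Rightarrow> real ^ 'n"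
    and C :: "nat \<Rightarrow> (real ^ 'n) set"
  assumes "tropical_rational_map f"
    and "linear_pieces f N g C"
    and "\<And>x M. M \<in> jacobian_hull N g C x \<Longrightarrow> invertible M"
  shows "tropical_isomorphism f"
proof -
  have cover: "(\<Union>i\<in>{1..N}. C i) = UNIV"
    and closed: "\<And>i. i \<in> {1..N} \<Longrightarrow> closed (C i)"
    and dim: "\<And>i. i \<in> {1..N} \<Longrightarrow> aff_dim (C i) = int CARD('n)"
    using assms(2) by (auto simp: linear_pieces_def polyhedron_imp_closed)
  \<comment> \<open>The empty set has affine dimension -1, so full dimension excludes it.\<close>
  have nonempty: "C i \<noteq> {}" if "i \<in> {1..N}" for i
    using dim[OF that] by auto
  have "\<forall>i\<in>{1..N}. \<exists>A b. g i = (\<lambda>x. A *v x + b)"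
    using assms(2) by (auto simp: linear_pieces_def linear_polynomial_map_def fun_eq_iff)
  then obtain A b where g: "\<And>i. i \<in> {1..N} \<Longrightarrow> g i = (\<lambda>x. A i *v x + b i)"
    by metis
  have f: "f x = A i *v x + b i" if "i \<in> {1..N}" "x \<in> C i" for i x
    using assms(2) g that by (simp add: linear_pieces_def)
  have hull: "jacobian_hull N g C x = convex hull (A ` active_pieces N C x)" for x
  proof -
    have "jacobian (g i) (at x) = A i" if "i \<in> active_pieces N C x" for i
      using that by (simp add: active_pieces_def g jacobian_affine)
    then show ?thesis
      by (simp add: jacobian_hull_def cong: image_cong)
  qed
  \<comment> \<open>Every piece is active at each of its own points, so its matrix belongs to some
    hull, where the hypothesis applies.\<close>
  have invertible: "invertible (A i)" if "i \<in> {1..N}" for i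
  proof -
    obtain x where "x \<in> C i" using nonempty[OF \<open>i \<in> {1..N}\<close>] by blast
    then have "A i \<in> jacobian_hull N g C x"
      unfolding hull using that by (intro hull_inc imageI) (simp add: active_pieces_def)
    then show ?thesis by (rule assms(3))
  qed
  have cont: "continuous_on UNIV f"
  proof -
    have "continuous_on (C i) f" if "i \<in> {1..N}" for i
    proof -
      have "continuous_on (C i) (\<lambda>x. A i *v x + b i)" by (intro continuous_intros)
      then show ?thesis using f[OF that] by (simp cong: continuous_on_cong)
    qed
    then have "continuous_on (\<Union>i\<in>{1..N}. C i) f"
      using closed by (intro continuous_on_closed_Union) auto
    then show ?thesis by (simp only: cover)
  qed
  moreover have "\<exists>r>0. inj_on f (ball x r)" for x
  proof -
    obtain r where r: "r > 0" "\<And>i. i \<in> {1..N} \<Longrightarrow> x \<notin> C i \<Longrightarrow> ball x r \<inter> C i = {}"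
      using ball_avoiding_finite_closed[of "{1..N}" C x] closed by auto
    have ball: "ball x r \<subseteq> (\<Union>i\<in>active_pieces N C x. C i)"
    proof
      fix y assume y: "y \<in> ball x r"
      have "y \<in> (\<Union>i\<in>{1..N}. C i)" by (simp only: cover UNIV_I)
      then obtain i where i: "i \<in> {1..N}" "y \<in> C i" by blast
      then have "x \<in> C i" using r(2) y by blast
      then show "y \<in> (\<Union>i\<in>active_pieces N C x. C i)"
        using i by (auto simp: active_pieces_def)
    qed
    have "inj_on f (ball x r)"
    proof
      fix y z assume yz: "y \<in> ball x r" "z \<in> ball x r" "f y = f z"
      \<comment> \<open>Convexity of the ball keeps the segment within the pieces active at the
        centre \<open>x\<close>. The matrix \<open>M\<close> therefore lies in the hull at
        \<open>x\<close>, whatever \<open>y\<close> and \<open>z\<close> are.\<close>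
      have "closed_segment y z \<subseteq> (\<Union>i\<in>active_pieces N C x. C i)"
        using closed_segment_subset[OF yz(1,2) convex_ball] ball by blast
      then have "\<exists>M\<in>convex hull (A ` active_pieces N C x). f z - f y = M *v (z - y)"
        using closed f
        by (intro piecewise_affine_mean_value[where C = C and b = b]) (auto simp: active_pieces_def)
      then obtain M where M: "M \<in> jacobian_hull N g C x" "M *v (z - y) = 0"
        using yz(3) hull by auto
      from assms(3)[OF M(1)] obtain B where "B ** M = mat 1"
        by (auto simp: invertible_def)
      then have "z - y = B *v (M *v (z - y))"
        by (simp add: matrix_vector_mul_assoc)
      then show "y = z" using M(2) by simp
    qed
    then show ?thesis using r(1) by blast
  qed
  moreover have "compact (f -` K)" if "compact K" for K
  proof -
    \<comment> \<open>Each point mapped into \<open>K\<close> lies in some piece, where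
      \<open>f\<close> is affine. The preimage is thus covered by finitely many affine preimages,
      each bounded by invertibility.\<close>
    have "f -` K \<subseteq> (\<Union>i\<in>{1..N}. {x. A i *v x + b i \<in> K})"
    proof
      fix x assume x: "x \<in> f -` K"
      have "x \<in> (\<Union>i\<in>{1..N}. C i)" by (simp only: cover UNIV_I)
      then show "x \<in> (\<Union>i\<in>{1..N}. {x. A i *v x + b i \<in> K})"
        using f x by force
    qed
    moreover have "bounded (\<Union>i\<in>{1..N}. {x. A i *v x + b i \<in> K})"
      using invertible compact_imp_bounded[OF that]
      by (intro bounded_UN) (auto intro: bounded_vimage_invertible_affine)
    ultimately have "bounded (f -` K)" by (rule bounded_subset[rotated])
    moreover have "closed (f -` K)"
      using cont compact_imp_closed[OF that] by (simp add: closed_vimage)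
    ultimately show ?thesis by (simp add: compact_eq_bounded_closed)
  qed
  ultimately have "bij f" by (rule proper_locally_injective_imp_bij)
  then show ?thesis using assms(1) by (simp add: tropical_isomorphism_def)
qed

end
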